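(* Let $\nu>-1/2$, $\alpha>0$, $\beta\in\mathbb{R}$ with $|\beta|<\alpha$, and $\mu\in\mathbb{R}$, and let $$p_{\mathrm{VG}}(x)=\frac{(\alpha^2-\beta^2)^{\nu+1/2}}{\sqrt{\pi}\,(2\alpha)^{\nu}\,\Gamma(\nu+1/2)}\,e^{\beta(x-\mu)}|x-\mu|^{\nu}K_{\nu}(\alpha|x-\mu|),\qquad x\in\mathbb{R}\setminus\{\mu\},$$ be the variance-gamma density. Then $p_{\mathrm{VG}}$ is log-convex on each of the intervals $(-\infty,\mu)$ and $(\mu,\infty)$ if and only if $-1/2<\nu\le 1/2$. The density $p_{\mathrm{VG}}$ is log-concave on each of these intervals if and only if $\nu\ge 1/2$. At $\nu=1/2$, the density $p_{\mathrm{VG}}$ is log-affine on each of these intervals.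
   Context: $K_\nu$ denotes the modified Bessel function of the second kind of order $\nu$. A positive function $h:I\to(0,\infty)$ on an interval $I\subseteq\mathbb{R}$ is log-convex on $I$ if $h(tx+(1-t)y)\le h(x)^t h(y)^{1-t}$ for all $x,y\in I$, $t\in[0,1]$, log-concave on $I$ if the reverse inequality holds for all such $x,y,t$, and log-affine on $I$ if $\log h$ is an affine function on $I$. *)

theory Defs
  imports "HOL-Analysis.Analysis"
begin

text \<open>
  The modified Bessel function of the second kind of real order \<open>\<nu>\<close>, by its integral
  representation on \<open>x > 0\<close>.  The integral diverges for \<open>x \<le> 0\<close>, where the value
  carries no meaning.
\<close>

definition bessel_K :: "real \<Rightarrow> real \<Rightarrow> real" where
  "bessel_K \<nu> x = (LINT t:{0..}|lborel. exp (- x * cosh t) * cosh (\<nu> * t))"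

text \<open>The density is only meaningful for \<open>x \<noteq> \<mu>\<close>; its value at \<open>x = \<mu>\<close> is irrelevant.\<close>

definition vg_density :: "real \<Rightarrow> real \<Rightarrow> real \<Rightarrow> real \<Rightarrow> real \<Rightarrow> real" where
  "vg_density \<nu> \<alpha> \<beta> \<mu> x =
     (\<alpha>\<^sup>2 - \<beta>\<^sup>2) powr (\<nu> + 1/2) / (sqrt pi * (2 * \<alpha>) powr \<nu> * Gamma (\<nu> + 1/2))
       * exp (\<beta> * (x - \<mu>)) * \<bar>x - \<mu>\<bar> powr \<nu> * bessel_K \<nu> (\<alpha> * \<bar>x - \<mu>\<bar>)"

text \<open>
  Positivity on the interval is part of each of the following notions, since \<open>powr\<close> and \<open>ln\<close>
  do not have their usual meaning at nonpositive arguments.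
\<close>

definition log_convex_on :: "real set \<Rightarrow> (real \<Rightarrow> real) \<Rightarrow> bool" where
  "log_convex_on I h \<longleftrightarrow> is_interval I \<and> (\<forall>x\<in>I. h x > 0) \<and>
     (\<forall>x\<in>I. \<forall>y\<in>I. \<forall>t\<in>{0..1}. h (t * x + (1 - t) * y) \<le> h x powr t * h y powr (1 - t))"

definition log_concave_on :: "real set \<Rightarrow> (real \<Rightarrow> real) \<Rightarrow> bool" where
  "log_concave_on I h \<longleftrightarrow> is_interval I \<and> (\<forall>x\<in>I. h x > 0) \<and>
     (\<forall>x\<in>I. \<forall>y\<in>I. \<forall>t\<in>{0..1}. h (t * x + (1 - t) * y) \<ge> h x powr t * h y powr (1 - t))"

definition log_affine_on :: "real set \<Rightarrow> (real \<Rightarrow> real) \<Rightarrow> bool" where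
  "log_affine_on I h \<longleftrightarrow> is_interval I \<and> (\<forall>x\<in>I. h x > 0) \<and>
     (\<exists>a b. \<forall>x\<in>I. ln (h x) = a * x + b)"

end

theory Submission imports Defs begin

text \<open>
  Up to an affine function, \<open>ln p\<^sub>V\<^sub>G\<close> on either side of \<open>\<mu>\<close> is \<open>L (\<alpha> \<bar>x - \<mu>\<bar>)\<close> with
  \<open>L x = ln (x\<^sup>\<nu> K\<^sub>\<nu> x)\<close>, so everything depends on the monotonicity of \<open>- L' = K\<^sub>\<nu>\<^sub>-\<^sub>1 / K\<^sub>\<nu>\<close>.
  The derivative of this ratio is \<open>T x / (x (K\<^sub>\<nu> x)\<^sup>2)\<close>, where
  \<open>T x = x ((K\<^sub>\<nu>\<^sub>-\<^sub>1 x)\<^sup>2 - (K\<^sub>\<nu> x)\<^sup>2) + (2\<nu> - 1) K\<^sub>\<nu> x K\<^sub>\<nu>\<^sub>-\<^sub>1 x\<close>.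
  The Bessel recurrences give \<open>T' x = - (2\<nu> - 1) K\<^sub>\<nu> x K\<^sub>\<nu>\<^sub>-\<^sub>1 x / x\<close>; since \<open>T\<close> vanishes at
  infinity, it has the sign of \<open>2\<nu> - 1\<close>.
\<close>

section \<open>Differentiation under the integral sign\<close>

text \<open>By the mean value inequality, \<open>g\<close> dominates the difference quotients along
  any sequence tending to \<open>x\<close>, so dominated convergence moves the limit inside the
  integral.\<close>

lemma has_real_derivative_lebesgue_integral:
  fixes f f' :: "real \<Rightarrow> 'a \<Rightarrow> real"
  assumes "0 < e"
    and int: "\<And>y. y \<in> ball x e \<Longrightarrow> integrable M (f y)"
    and deriv: "\<And>y t. y \<in> ball x e \<Longrightarrow> t \<in> space M \<Longrightarrow>
      ((\<lambda>y. f y t) has_real_derivative f' y t) (at y)"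
    and bound: "\<And>y t. y \<in> ball x e \<Longrightarrow> t \<in> space M \<Longrightarrow> \<bar>f' y t\<bar> \<le> g t"
    and g: "integrable M g"
    and meas: "f' x \<in> borel_measurable M"
  shows "((\<lambda>y. integral\<^sup>L M (f y)) has_real_derivative integral\<^sup>L M (f' x)) (at x)"
  unfolding has_field_derivative_iff
proof (subst tendsto_at_iff_sequentially, intro allI impI)
  fix X :: "nat \<Rightarrow> real"
  assume X: "\<forall>i. X i \<in> UNIV - {x}" and lim: "X \<longlonglongrightarrow> x"
  obtain N where N: "\<And>n. N \<le> n \<Longrightarrow> X n \<in> ball x e"
    using tendstoD[OF lim \<open>0 < e\<close>] by (auto simp: eventually_sequentially dist_commute)
  \<comment> \<open>Dropping the first \<open>N\<close> terms leaves a sequence lying entirely in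
    the ball where the hypotheses apply.\<close>
  define Y where "Y n = X (n + N)" for n
  have Yb: "Y n \<in> ball x e" and Ynx: "Y n \<noteq> x" for n
    using N X by (auto simp: Y_def)
  have x: "x \<in> ball x e" using \<open>0 < e\<close> by simp
  have Ylim: "Y \<longlonglongrightarrow> x"
    unfolding Y_def by (rule LIMSEQ_ignore_initial_segment[OF lim])
  have "(\<lambda>n. LINT t|M. (f (Y n) t - f x t) / (Y n - x)) \<longlonglongrightarrow> integral\<^sup>L M (f' x)"
  proof (rule integral_dominated_convergence[where w = g, OF meas _ g])
    show "(\<lambda>t. (f (Y n) t - f x t) / (Y n - x)) \<in> borel_measurable M" for n
      using int[OF Yb] int[OF x] by (intro borel_measurable_divide borel_measurable_diff) auto
    show "AE t in M. (\<lambda>n. (f (Y n) t - f x t) / (Y n - x)) \<longlonglongrightarrow> f' x t"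
    proof (rule AE_I2)
      fix t assume "t \<in> space M"
      then have "((\<lambda>y. (f y t - f x t) / (y - x)) \<longlongrightarrow> f' x t) (at x)"
        using deriv[OF x] by (simp add: has_field_derivative_iff)
      then show "(\<lambda>n. (f (Y n) t - f x t) / (Y n - x)) \<longlonglongrightarrow> f' x t"
        using Ylim Ynx unfolding tendsto_at_iff_sequentially comp_def by auto
    qed
    show "AE t in M. norm ((f (Y n) t - f x t) / (Y n - x)) \<le> g t" for n
    proof (rule AE_I2)
      fix t assume t: "t \<in> space M"
      have "norm (f (Y n) t - f x t) \<le> g t * norm (Y n - x)"
        using bound t Yb x
        by (intro field_differentiable_bound[OF convex_ball[of x e], where f = "\<lambda>y. f y t" and f' = "\<lambda>y. f' y t"]
            DERIV_subset[OF deriv]) auto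
      then show "norm ((f (Y n) t - f x t) / (Y n - x)) \<le> g t"
        using Ynx[of n] by (simp add: divide_simps)
    qed
  qed
  moreover have "(LINT t|M. (f (Y n) t - f x t) / (Y n - x)) =
      (integral\<^sup>L M (f (Y n)) - integral\<^sup>L M (f x)) / (Y n - x)" for n
    using int[OF Yb] int[OF x] by simp
  ultimately have "(\<lambda>n. (integral\<^sup>L M (f (Y n)) - integral\<^sup>L M (f x)) / (Y n - x))
      \<longlonglongrightarrow> integral\<^sup>L M (f' x)"
    by (simp only:)
  then show "((\<lambda>y. (integral\<^sup>L M (f y) - integral\<^sup>L M (f x)) / (y - x)) \<circ> X)
      \<longlonglongrightarrow> integral\<^sup>L M (f' x)"
    unfolding Y_def by (auto simp: comp_def intro: LIMSEQ_offset[where k = N])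
qed

section \<open>Integrability and positivity of the Bessel integral\<close>

text \<open>The quadratic growth of \<open>cosh\<close> beats the linear exponent
  \<open>\<bar>\<nu>\<bar> * t\<close>. The extra \<open>1\<close> in
  \<open>\<bar>\<nu>\<bar> + 1\<close> leaves the factor \<open>exp (- t)\<close>, which serves both
  integrability and the vanishing of boundary terms at infinity.\<close>

lemma bessel_K_integrand_bound:
  fixes x \<nu> t :: real
  assumes "0 < x" "0 \<le> t"
  shows "exp (- x * cosh t) * cosh (\<nu> * t) \<le> exp ((\<bar>\<nu>\<bar> + 1)\<^sup>2 / x) * exp (- t)"
proof -
  define a where "a = \<bar>\<nu>\<bar> + 1"
  \<comment> \<open>Half of \<open>exp t \<ge> 1 + t + t^2 / 2\<close>, with the other nonnegative
    terms dropped.\<close>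
  have "t\<^sup>2 / 4 \<le> cosh t"
    using exp_lower_Taylor_quadratic[OF \<open>0 \<le> t\<close>] assms exp_gt_zero[of "-t"]
    unfolding cosh_field_def by argo
  then have "x * (t\<^sup>2 / 4) \<le> x * cosh t"
    using assms by simp
  \<comment> \<open>Completing the square: expanded, this reads
    \<open>a^2 / x - a * t + x * t^2 / 4\<close>.\<close>
  moreover have "0 \<le> (a - x * t / 2)\<^sup>2 / x"
    using assms by simp
  then have "a * t \<le> a\<^sup>2 / x + x * (t\<^sup>2 / 4)"
    using assms by (simp add: field_simps power2_eq_square)
  ultimately have "\<bar>\<nu>\<bar> * t - x * cosh t \<le> a\<^sup>2 / x - t"
    by (simp add: a_def algebra_simps)
  have "cosh (\<nu> * t) = (exp (\<nu> * t) + exp (- (\<nu> * t))) / 2"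
    by (simp add: cosh_def)
  also have "\<dots> \<le> exp (\<bar>\<nu>\<bar> * t)"
  proof -
    have "exp (\<nu> * t) \<le> exp (\<bar>\<nu>\<bar> * t)" "exp (- (\<nu> * t)) \<le> exp (\<bar>\<nu>\<bar> * t)"
      using assms abs_ge_self[of "\<nu> * t"] abs_ge_minus_self[of "\<nu> * t"] by (simp_all add: abs_mult)
    then show ?thesis by argo
  qed
  finally have "exp (- x * cosh t) * cosh (\<nu> * t) \<le> exp (- x * cosh t) * exp (\<bar>\<nu>\<bar> * t)"
    by simp
  also have "\<dots> = exp (\<bar>\<nu>\<bar> * t - x * cosh t)"
    by (simp flip: exp_add)
  also have "\<dots> \<le> exp (a\<^sup>2 / x - t)"
    using \<open>\<bar>\<nu>\<bar> * t - x * cosh t \<le> a\<^sup>2 / x - t\<close> by simp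
  also have "\<dots> = exp (a\<^sup>2 / x) * exp (- t)"
    by (simp flip: exp_add)
  finally show ?thesis unfolding a_def .
qed

lemma set_integrable_exp_minus_Ici: "set_integrable lborel {0..} (\<lambda>t::real. exp (- t))"
proof -
  have "(\<integral>\<^sup>+t. ennreal (exp (- t)) * indicator {0..} t \<partial>lborel) = ennreal (0 - - exp (- 0 :: real))"
  proof (rule nn_integral_FTC_atLeast)
    show "((\<lambda>t::real. - exp (- t)) \<longlongrightarrow> 0) at_top"
      using tendsto_minus[OF filterlim_compose[OF exp_at_bot filterlim_uminus_at_bot_at_top]] by simp
  qed (auto intro!: derivative_eq_intros)
  moreover have "(\<integral>\<^sup>+t. ennreal (exp (- t)) * indicator {0..} t \<partial>lborel) =
      (\<integral>\<^sup>+t. ennreal (norm (indicator {0..} t *\<^sub>R exp (- t :: real))) \<partial>lborel)"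
    by (intro nn_integral_cong) (auto simp: indicator_def)
  ultimately show ?thesis
    unfolding set_integrable_def by (intro integrableI_bounded) auto
qed

lemma bessel_K_integrable:
  fixes x \<nu> :: real
  assumes "0 < x"
  shows "set_integrable lborel {0..} (\<lambda>t. exp (- x * cosh t) * cosh (\<nu> * t))"
proof (rule set_integrable_bound)
  show "set_integrable lborel {0..} (\<lambda>t. exp ((\<bar>\<nu>\<bar> + 1)\<^sup>2 / x) * exp (- t))"
    using set_integrable_exp_minus_Ici by (rule set_integrable_mult_right)
  show "set_borel_measurable lborel {0..} (\<lambda>t. exp (- x * cosh t) * cosh (\<nu> * t))"
    unfolding set_borel_measurable_def cosh_field_def by measurable
  show "AE t in lborel. t \<in> {0..} \<longrightarrow>
      norm (exp (- x * cosh t) * cosh (\<nu> * t)) \<le> norm (exp ((\<bar>\<nu>\<bar> + 1)\<^sup>2 / x) * exp (- t))"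
    using bessel_K_integrand_bound[OF assms] by (intro AE_I2) (auto simp: abs_mult)
qed

text \<open>The integrand is nonnegative, and on \<open>[0, 1]\<close> it is at least the constant
  \<open>exp (- x * cosh 1)\<close>, whose integral over that interval is itself.\<close>

lemma bessel_K_pos:
  assumes "0 < x"
  shows "0 < bessel_K \<nu> x"
proof -
  have "exp (- x * cosh 1) = (LINT t:{0..1::real}|lborel. exp (- x * cosh 1))"
    by (simp add: set_lebesgue_integral_def content_real)
  also have "\<dots> \<le> bessel_K \<nu> x"
    unfolding bessel_K_def set_lebesgue_integral_def
  proof (rule integral_mono)
    show "integrable lborel (\<lambda>t::real. indicator {0..1} t *\<^sub>R exp (- x * cosh 1))"
      by (intro integrable_scaleR_left integrable_real_indicator) auto
    show "integrable lborel (\<lambda>t. indicator {0..} t *\<^sub>R (exp (- x * cosh t) * cosh (\<nu> * t)))"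
      using bessel_K_integrable[OF assms] by (simp add: set_integrable_def)
    fix t :: real
    have "exp (- x * cosh 1) \<le> exp (- x * cosh t) * cosh (\<nu> * t)" if "0 \<le> t" "t \<le> 1"
    proof -
      have "exp (- x * cosh 1) \<le> exp (- x * cosh t)"
        using that assms by (simp add: cosh_real_nonneg_le_iff)
      also have "\<dots> \<le> exp (- x * cosh t) * cosh (\<nu> * t)"
        using cosh_real_ge_1[of "\<nu> * t"] by simp
      finally show ?thesis .
    qed
    then show "indicator {0..1} t *\<^sub>R exp (- x * cosh 1) \<le>
        indicator {0..} t *\<^sub>R (exp (- x * cosh t) * cosh (\<nu> * t))"
      by (auto simp: indicator_def)
  qed
  finally show ?thesis
    by (rule less_le_trans[OF exp_gt_zero])
qed

section \<open>Derivatives, recurrence and exponential decay of \<open>bessel_K\<close>\<close>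

text \<open>Differentiating the integrand brings down \<open>- cosh t\<close>, and the
  product-to-sum identity for \<open>cosh t * cosh (\<nu> * t)\<close> splits the result into the
  integrands of the two neighbouring orders.\<close>

lemma bessel_K_has_real_derivative:
  assumes "0 < x"
  shows "(bessel_K \<nu> has_real_derivative - (bessel_K (\<nu> - 1) x + bessel_K (\<nu> + 1) x) / 2) (at x)"
proof -
  \<comment> \<open>\<open>f'\<close> is written with the neighbouring orders so that its integral
    can be read off; the product form proved below serves for differentiation and the bound.\<close>
  define f f' where "f y t = indicator {0..} t *\<^sub>R (exp (- y * cosh t) * cosh (\<nu> * t))"
    and "f' y t = - (indicator {0..} t *\<^sub>R (exp (- y * cosh t) * cosh ((\<nu> - 1) * t)) +
      indicator {0..} t *\<^sub>R (exp (- y * cosh t) * cosh ((\<nu> + 1) * t))) / 2" for y t :: real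
  have cosh_mult: "cosh ((\<nu> - 1) * t) + cosh ((\<nu> + 1) * t) = 2 * (cosh t * cosh (\<nu> * t))" for t
    by (simp add: cosh_add cosh_diff algebra_simps)
  have f': "f' y t = indicator {0..} t * (- cosh t * exp (- y * cosh t) * cosh (\<nu> * t))" for y t
  proof -
    have "f' y t = - indicator {0..} t * exp (- y * cosh t) * (cosh ((\<nu> - 1) * t) + cosh ((\<nu> + 1) * t)) / 2"
      by (simp add: f'_def algebra_simps)
    then show ?thesis by (simp add: cosh_mult)
  qed
  have int: "integrable lborel (\<lambda>t. indicator {0..} t *\<^sub>R (exp (- y * cosh t) * cosh (\<kappa> * t)))"
    if "0 < y" for y \<kappa> :: real
    using bessel_K_integrable[OF that] by (simp add: set_integrable_def)
  have "((\<lambda>y. integral\<^sup>L lborel (f y)) has_real_derivative integral\<^sup>L lborel (f' x)) (at x)"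
  proof (rule has_real_derivative_lebesgue_integral)
    \<comment> \<open>With radius \<open>x / 2\<close> every \<open>y\<close> in the ball exceeds
      \<open>x / 2\<close>, so \<open>- f' (x / 2)\<close> is an integrable majorant.\<close>
    show "0 < x / 2" using assms by simp
    fix y assume "y \<in> ball x (x / 2)"
    then have y: "x / 2 < y" "0 < y" using assms by (auto simp: dist_real_def abs_if split: if_splits)
    show "integrable lborel (f y)"
      unfolding f_def using int[OF \<open>0 < y\<close>] .
    fix t :: real
    show "((\<lambda>y. f y t) has_real_derivative f' y t) (at y)"
      unfolding f_def f' by (auto intro!: derivative_eq_intros)
    have "exp (- y * cosh t) \<le> exp (- (x / 2) * cosh t)"
      using y cosh_real_pos[of t] by simp
    then show "\<bar>f' y t\<bar> \<le> - f' (x / 2) t"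
      unfolding f' by (auto simp: indicator_def abs_mult)
  next
    show "integrable lborel (\<lambda>t. - f' (x / 2) t)"
      unfolding f'_def using int[of "x / 2"] assms
      by (intro integrable_minus integrable_divide integrable_add) auto
    show "f' x \<in> borel_measurable lborel"
      unfolding f'_def cosh_field_def by measurable
  qed
  moreover have "integral\<^sup>L lborel (f' x) = - (bessel_K (\<nu> - 1) x + bessel_K (\<nu> + 1) x) / 2"
    unfolding f'_def bessel_K_def set_lebesgue_integral_def using int[OF assms] by simp
  ultimately show ?thesis
    unfolding f_def bessel_K_def[abs_def] set_lebesgue_integral_def by simp
qed

lemma bessel_K_recurrence:
  assumes "0 < x"
  shows "x * (bessel_K (\<nu> + 1) x - bessel_K (\<nu> - 1) x) = 2 * \<nu> * bessel_K \<nu> x"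
proof -
  define I where "I \<kappa> t = exp (- x * cosh t) * cosh (\<kappa> * t)" for \<kappa> t :: real
  define F where "F t = exp (- x * cosh t) * sinh (\<nu> * t)" for t :: real
  \<comment> \<open>The recurrence is the integral of \<open>F'\<close>, since \<open>F\<close> vanishes at \<open>0\<close> and at infinity.\<close>
  define F' where "F' t = \<nu> * I \<nu> t - x / 2 * (I (\<nu> + 1) t - I (\<nu> - 1) t)" for t
  \<comment> \<open>The exponential contributes \<open>sinh t * sinh (\<nu> * t)\<close>, which is
    half the difference of \<open>cosh ((\<nu> + 1) * t)\<close> and
    \<open>cosh ((\<nu> - 1) * t)\<close>.\<close>
  have F: "(F has_real_derivative F' t) (at t)" for t
    unfolding F_def F'_def I_def
    by (auto intro!: derivative_eq_intros simp: cosh_add cosh_diff algebra_simps)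
  have int: "set_integrable lborel {0..} (I \<kappa>)" for \<kappa>
    unfolding I_def using bessel_K_integrable[OF assms] .
  have int': "set_integrable lborel {0..} F'"
    unfolding F'_def by (intro set_integral_diff set_integrable_mult_right int)
  have "((\<lambda>b. LINT t:{0..b}|lborel. F' t) \<longlongrightarrow> (LINT t:{0..}|lborel. F' t)) at_top"
    by (rule tendsto_set_lebesgue_integral_at_top[OF _ int']) auto
  moreover have "\<forall>\<^sub>F b in at_top. (LINT t:{0..b}|lborel. F' t) = F b"
    using eventually_ge_at_top[of 0]
  proof eventually_elim
    case (elim b)
    have "(LINT t:{0..b}|lborel. F' t) = F b - F 0"
      unfolding set_lebesgue_integral_def
    proof (rule integral_FTC_Icc[OF elim])
      show "(F has_vector_derivative F' t) (at t within {0..b})" for t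
        by (rule has_vector_derivative_at_within[OF
              has_real_derivative_iff_has_vector_derivative[THEN iffD1, OF F]])
      show "continuous_on {0..b} F'"
        unfolding F'_def I_def by (auto intro!: continuous_intros)
    qed
    then show ?case by (simp add: F_def)
  qed
  ultimately have "(F \<longlongrightarrow> (LINT t:{0..}|lborel. F' t)) at_top"
    by (simp add: tendsto_cong)
  moreover have "(F \<longlongrightarrow> 0) at_top"
  proof (rule Lim_null_comparison)
    show "\<forall>\<^sub>F t in at_top. norm (F t) \<le> exp ((\<bar>\<nu>\<bar> + 1)\<^sup>2 / x) * exp (- t)"
      using eventually_ge_at_top[of 0]
    proof eventually_elim
      case (elim t)
      \<comment> \<open>This is \<open>\<bar>sinh u\<bar> \<le> cosh u\<close>; the negative side is
        \<open>sinh_le_cosh_real\<close> at \<open>- u\<close>.\<close>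
      have "norm (F t) \<le> exp (- x * cosh t) * cosh (\<nu> * t)"
        by (simp add: F_def abs_mult abs_le_iff sinh_le_cosh_real)
          (smt (verit) cosh_minus sinh_minus sinh_le_cosh_real)
      also have "\<dots> \<le> exp ((\<bar>\<nu>\<bar> + 1)\<^sup>2 / x) * exp (- t)"
        by (rule bessel_K_integrand_bound[OF assms elim])
      finally show ?case .
    qed
    show "((\<lambda>t. exp ((\<bar>\<nu>\<bar> + 1)\<^sup>2 / x) * exp (- t)) \<longlongrightarrow> 0) at_top"
      by (intro tendsto_mult_right_zero filterlim_compose[OF exp_at_bot filterlim_uminus_at_bot_at_top])
  qed
  ultimately have "(LINT t:{0..}|lborel. F' t) = 0"
    by (rule tendsto_unique[OF trivial_limit_at_top_linorder])
  moreover have "(LINT t:{0..}|lborel. F' t) =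
      \<nu> * bessel_K \<nu> x - x / 2 * (bessel_K (\<nu> + 1) x - bessel_K (\<nu> - 1) x)"
    unfolding F'_def bessel_K_def I_def[symmetric]
    by (simp add: int set_integral_diff)
  ultimately show ?thesis by (simp add: field_simps)
qed

text \<open>As \<open>cosh t \<ge> 1\<close>, raising the argument from \<open>1\<close> to
  \<open>x\<close> multiplies the integrand by at most \<open>exp (1 - x)\<close>.\<close>

lemma bessel_K_exp_bound:
  assumes "1 \<le> x"
  shows "bessel_K \<nu> x \<le> exp (1 - x) * bessel_K \<nu> 1"
proof -
  have "bessel_K \<nu> x \<le> (LINT t:{0..}|lborel. exp (1 - x) * (exp (- 1 * cosh t) * cosh (\<nu> * t)))"
    unfolding bessel_K_def
  proof (rule set_integral_mono)
    fix t :: real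
    have "(x - 1) * 1 \<le> (x - 1) * cosh t"
      using assms cosh_real_ge_1[of t] by (intro mult_left_mono) auto
    then have "exp (- x * cosh t) \<le> exp (1 - x) * exp (- 1 * cosh t)"
      by (simp add: algebra_simps flip: exp_add)
    then show "exp (- x * cosh t) * cosh (\<nu> * t) \<le> exp (1 - x) * (exp (- 1 * cosh t) * cosh (\<nu> * t))"
      by (simp add: mult.assoc[symmetric])
  qed (use assms in \<open>intro set_integrable_mult_right bessel_K_integrable; simp\<close>)+
  then show ?thesis by (simp add: bessel_K_def)
qed

lemma bessel_K_minus [simp]: "bessel_K (- \<nu>) x = bessel_K \<nu> x"
  by (simp add: bessel_K_def)

text \<open>The recurrence eliminates order \<open>\<nu> + 1\<close>. Together with the next lemma
  this closes the pair of orders \<open>\<nu>\<close> and \<open>\<nu> - 1\<close> under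
  differentiation.\<close>

lemma bessel_K_has_real_derivative_lower:
  assumes "0 < x"
  shows "(bessel_K \<nu> has_real_derivative - bessel_K (\<nu> - 1) x - \<nu> / x * bessel_K \<nu> x) (at x)"
proof -
  have "- (bessel_K (\<nu> - 1) x + bessel_K (\<nu> + 1) x) / 2 = - bessel_K (\<nu> - 1) x - \<nu> / x * bessel_K \<nu> x"
    using bessel_K_recurrence[OF assms, of \<nu>] assms by (simp add: field_simps)
  then show ?thesis
    using bessel_K_has_real_derivative[OF assms, of \<nu>] by (simp only:)
qed

text \<open>The preceding formula at order \<open>1 - \<nu>\<close>, read through the symmetry of
  \<open>bessel_K\<close> in its order.\<close>

lemma bessel_K_pred_has_real_derivative:
  assumes "0 < x"
  shows "(bessel_K (\<nu> - 1) has_real_derivative - bessel_K \<nu> x + (\<nu> - 1) / x * bessel_K (\<nu> - 1) x) (at x)"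
proof -
  have "bessel_K (1 - \<nu>) = bessel_K (\<nu> - 1)"
    using bessel_K_minus[of "\<nu> - 1"] by (intro ext) simp
  moreover have "- bessel_K (1 - \<nu> - 1) x - (1 - \<nu>) / x * k = - bessel_K \<nu> x + (\<nu> - 1) / x * k" for k
    by (simp add: diff_divide_distrib left_diff_distrib)
  ultimately show ?thesis
    using bessel_K_has_real_derivative_lower[OF assms, of "1 - \<nu>"] by (simp only:)
qed

text \<open>Cases \<open>k = 0\<close> and \<open>k = 1\<close> of one statement: exponential decay
  beats every power \<open>x ^ k\<close>.\<close>

lemma bessel_K_tendsto_0: "(bessel_K \<nu> \<longlongrightarrow> 0) at_top"
  and mult_bessel_K_tendsto_0: "((\<lambda>x. x * bessel_K \<nu> x) \<longlongrightarrow> 0) at_top"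
proof -
  have lim: "((\<lambda>x::real. x ^ k * exp (1 - x) * bessel_K \<nu> 1) \<longlongrightarrow> 0) at_top" for k
    using tendsto_mult_right_zero[OF tendsto_power_div_exp_0[of k], of "exp 1 * bessel_K \<nu> 1"]
    by (simp add: exp_diff mult_ac)
  have bound: "norm (x ^ k * bessel_K \<nu> x) \<le> x ^ k * exp (1 - x) * bessel_K \<nu> 1" if "1 \<le> x" for x k
    using that bessel_K_exp_bound[OF that, of \<nu>] bessel_K_pos[of x \<nu>]
    by (simp add: abs_mult mult.assoc mult_left_mono)
  have "((\<lambda>x. x ^ k * bessel_K \<nu> x) \<longlongrightarrow> 0) at_top" for k
    by (rule Lim_null_comparison[OF _ lim[of k]])
      (rule eventually_mono[OF eventually_ge_at_top[of 1] bound])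
  from this[of 0] this[of 1] show "(bessel_K \<nu> \<longlongrightarrow> 0) at_top"
    "((\<lambda>x. x * bessel_K \<nu> x) \<longlongrightarrow> 0) at_top"
    by simp_all
qed

section \<open>The sign of the Turan-type expression \<open>T\<close>\<close>

text \<open>For \<open>x > 0\<close> this is \<open>x\<close> times the Wronskian
  \<open>B' * A - B * A'\<close> with \<open>A = bessel_K \<nu>\<close> and
  \<open>B = bessel_K (\<nu> - 1)\<close>, that is, the numerator of \<open>(B / A)'\<close> cleared
  of \<open>1 / x\<close>.\<close>

definition bessel_K_turan :: "real \<Rightarrow> real \<Rightarrow> real" where
  "bessel_K_turan \<nu> x = x * ((bessel_K (\<nu> - 1) x)\<^sup>2 - (bessel_K \<nu> x)\<^sup>2)
     + (2 * \<nu> - 1) * (bessel_K \<nu> x * bessel_K (\<nu> - 1) x)"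

text \<open>All squares cancel, and so do the products carrying a factor \<open>x\<close>. What
  survives has constant sign because both Bessel functions are positive.\<close>

lemma bessel_K_turan_has_real_derivative:
  assumes "0 < x"
  shows "(bessel_K_turan \<nu> has_real_derivative
    - ((2 * \<nu> - 1) * (bessel_K \<nu> x * bessel_K (\<nu> - 1) x / x))) (at x)"
  unfolding bessel_K_turan_def[abs_def] using assms
  by (auto intro!: derivative_eq_intros bessel_K_has_real_derivative_lower[OF assms]
      bessel_K_pred_has_real_derivative[OF assms] simp: field_simps power2_eq_square)

lemma bessel_K_turan_tendsto_0: "(bessel_K_turan \<nu> \<longlongrightarrow> 0) at_top"
proof -
  have "((\<lambda>x. (x * bessel_K (\<nu> - 1) x) * bessel_K (\<nu> - 1) x - (x * bessel_K \<nu> x) * bessel_K \<nu> x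
     + (2 * \<nu> - 1) * (bessel_K \<nu> x * bessel_K (\<nu> - 1) x)) \<longlongrightarrow> 0 * 0 - 0 * 0 + (2 * \<nu> - 1) * (0 * 0)) at_top"
    by (intro tendsto_intros bessel_K_tendsto_0 mult_bessel_K_tendsto_0)
  then show ?thesis
    by (simp add: bessel_K_turan_def[abs_def] power2_eq_square algebra_simps)
qed

lemma DERIV_neg_tendsto_0_imp_pos:
  fixes f f' :: "real \<Rightarrow> real"
  assumes "\<And>y. x \<le> y \<Longrightarrow> (f has_real_derivative f' y) (at y)"
    and "\<And>y. x \<le> y \<Longrightarrow> f' y < 0"
    and lim: "(f \<longlongrightarrow> 0) at_top"
  shows "0 < f x"
proof -
  have decr: "f z < f y" if "x \<le> y" "y < z" for y z
    using assms(1,2) that by (intro DERIV_neg_imp_decreasing[OF that(2)]) (meson order_trans)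
  \<comment> \<open>The limit yields only a weak inequality, so it is taken at \<open>x + 1\<close>;
    the strict decrease from \<open>x\<close> to \<open>x + 1\<close> then gives strictness.\<close>
  have "0 \<le> f (x + 1)"
    by (rule tendsto_upperbound[OF lim eventually_mono[OF eventually_gt_at_top[of "x + 1"]]])
      (auto intro!: less_imp_le decr)
  also have "\<dots> < f x"
    by (rule decr) auto
  finally show ?thesis .
qed

lemma bessel_K_turan_pos:
  assumes "0 < x" "1 / 2 < \<nu>"
  shows "0 < bessel_K_turan \<nu> x"
  using assms bessel_K_turan_tendsto_0
  by (intro DERIV_neg_tendsto_0_imp_pos[OF bessel_K_turan_has_real_derivative])
    (auto intro!: mult_pos_pos divide_pos_pos bessel_K_pos)

text \<open>Here \<open>T\<close> increases to \<open>0\<close>, so the decreasing case is applied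
  to \<open>- T\<close>.\<close>

lemma bessel_K_turan_neg:
  assumes "0 < x" "\<nu> < 1 / 2"
  shows "bessel_K_turan \<nu> x < 0"
proof -
  have "0 < - bessel_K_turan \<nu> x"
    using assms tendsto_minus[OF bessel_K_turan_tendsto_0[of \<nu>]]
    by (intro DERIV_neg_tendsto_0_imp_pos[OF DERIV_minus[OF bessel_K_turan_has_real_derivative]])
      (auto intro!: divide_neg_pos mult_neg_pos mult_pos_pos bessel_K_pos)
  then show ?thesis by simp
qed

section \<open>Monotonicity of the Bessel ratio and convexity of
  \<open>ln_powr_bessel_K\<close>\<close>

definition bessel_K_ratio :: "real \<Rightarrow> real \<Rightarrow> real" where
  "bessel_K_ratio \<nu> x = bessel_K (\<nu> - 1) x / bessel_K \<nu> x"

text \<open>The orders \<open>- 1 / 2\<close> and \<open>1 / 2\<close> give the same function by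
  symmetry.\<close>

lemma bessel_K_ratio_half:
  assumes "0 < x"
  shows "bessel_K_ratio (1 / 2) x = 1"
  using bessel_K_pos[OF assms, of "1 / 2"] bessel_K_minus[of "1 / 2" x] by (simp add: bessel_K_ratio_def)

lemma bessel_K_ratio_has_real_derivative:
  assumes "0 < x"
  shows "(bessel_K_ratio \<nu> has_real_derivative bessel_K_turan \<nu> x / (x * (bessel_K \<nu> x)\<^sup>2)) (at x)"
  unfolding bessel_K_ratio_def[abs_def] bessel_K_turan_def using assms bessel_K_pos[OF assms, of \<nu>]
  by (auto intro!: derivative_eq_intros bessel_K_has_real_derivative_lower[OF assms]
      bessel_K_pred_has_real_derivative[OF assms] simp: field_simps power2_eq_square)

lemma bessel_K_ratio_strict_mono:
  assumes "1 / 2 < \<nu>" "0 < x" "x < y"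
  shows "bessel_K_ratio \<nu> x < bessel_K_ratio \<nu> y"
proof (rule DERIV_pos_imp_increasing[OF \<open>x < y\<close>])
  fix z assume "x \<le> z" "z \<le> y"
  then have "0 < z" using assms by simp
  then have "0 < bessel_K_turan \<nu> z / (z * (bessel_K \<nu> z)\<^sup>2)"
    using bessel_K_turan_pos[OF _ assms(1)] bessel_K_pos[of z \<nu>] by simp
  then show "\<exists>d. (bessel_K_ratio \<nu> has_real_derivative d) (at z) \<and> 0 < d"
    using bessel_K_ratio_has_real_derivative[OF \<open>0 < z\<close>] by blast
qed

lemma bessel_K_ratio_strict_antimono:
  assumes "\<nu> < 1 / 2" "0 < x" "x < y"
  shows "bessel_K_ratio \<nu> y < bessel_K_ratio \<nu> x"
proof (rule DERIV_neg_imp_decreasing[OF \<open>x < y\<close>])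
  fix z assume "x \<le> z" "z \<le> y"
  then have "0 < z" using assms by simp
  then have "bessel_K_turan \<nu> z / (z * (bessel_K \<nu> z)\<^sup>2) < 0"
    using bessel_K_turan_neg[OF _ assms(1)] bessel_K_pos[of z \<nu>] by (simp add: divide_neg_pos)
  then show "\<exists>d. (bessel_K_ratio \<nu> has_real_derivative d) (at z) \<and> d < 0"
    using bessel_K_ratio_has_real_derivative[OF \<open>0 < z\<close>] by blast
qed

definition ln_powr_bessel_K :: "real \<Rightarrow> real \<Rightarrow> real" where
  "ln_powr_bessel_K \<nu> x = \<nu> * ln x + ln (bessel_K \<nu> x)"

text \<open>The term \<open>\<nu> / x\<close> from the power cancels the \<open>- \<nu> / x\<close>
  in the logarithmic derivative of \<open>bessel_K \<nu>\<close>, leaving the ratio alone.\<close>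

lemma ln_powr_bessel_K_has_real_derivative:
  assumes "0 < x"
  shows "(ln_powr_bessel_K \<nu> has_real_derivative - bessel_K_ratio \<nu> x) (at x)"
  unfolding ln_powr_bessel_K_def[abs_def] bessel_K_ratio_def
  using assms bessel_K_pos[OF assms, of \<nu>]
  by (auto intro!: derivative_eq_intros bessel_K_has_real_derivative_lower[OF assms] simp: field_simps)

text \<open>The second claim supplies the only-if directions: by the mean value theorem the
  increment over \<open>[2, 3]\<close> exceeds that over \<open>[1, 2]\<close>, which contradicts
  concavity at the midpoint \<open>2\<close>.\<close>

lemma strict_mono_deriv_imp_convex_not_concave:
  fixes f f' :: "real \<Rightarrow> real"
  assumes deriv: "\<And>x. 0 < x \<Longrightarrow> (f has_real_derivative f' x) (at x)"
    and less: "\<And>x y. 0 < x \<Longrightarrow> x < y \<Longrightarrow> f' x < f' y"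
  shows "convex_on {0<..} f" "\<not> concave_on {0<..} f"
proof -
  show "convex_on {0<..} f"
    by (rule convex_on_realI[OF _ deriv]) (auto simp: le_less less)
  obtain a where a: "1 < a" "a < 2" "f 2 - f 1 = (2 - 1) * f' a"
    using MVT2[of 1 2 f f'] deriv by auto
  obtain b where b: "2 < b" "b < 3" "f 3 - f 2 = (3 - 2) * f' b"
    using MVT2[of 2 3 f f'] deriv by auto
  have "f' a < f' b" using less a b by simp
  then have "2 * f 2 < f 1 + f 3" using a b by simp
  moreover have "2 * f 2 \<ge> f 1 + f 3" if "concave_on {0<..} f"
    using concave_onD[OF that, of "1/2" 1 3] by simp
  ultimately show "\<not> concave_on {0<..} f" by linarith
qed

text \<open>At this order the ratio is \<open>1\<close>, so adding \<open>x\<close> gives a function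
  with zero derivative.\<close>

lemma ln_powr_bessel_K_half:
  obtains c where "\<And>x. 0 < x \<Longrightarrow> ln_powr_bessel_K (1 / 2) x = c - x"
proof -
  have "\<exists>c. \<forall>x\<in>{0<..}. ln_powr_bessel_K (1 / 2) x + x = c"
  proof (rule has_field_derivative_zero_constant)
    fix x :: real assume "x \<in> {0<..}"
    then have "0 < x" by simp
    then show "((\<lambda>x. ln_powr_bessel_K (1 / 2) x + x) has_real_derivative 0) (at x within {0<..})"
      using DERIV_add[OF ln_powr_bessel_K_has_real_derivative[OF \<open>0 < x\<close>, of "1 / 2"] DERIV_ident]
      by (simp add: bessel_K_ratio_half has_field_derivative_at_within)
  qed simp
  then show ?thesis using that by (metis add_diff_cancel_right' greaterThan_iff)
qed

text \<open>Each case of the trichotomy at \<open>1 / 2\<close> decides both equivalences: below,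
  the derivative \<open>- bessel_K_ratio \<nu>\<close> strictly increases; above, the negated
  function has strictly increasing derivative; at \<open>1 / 2\<close> the derivative is
  constant.\<close>

lemma convex_on_ln_powr_bessel_K_iff: "convex_on {0<..} (ln_powr_bessel_K \<nu>) \<longleftrightarrow> \<nu> \<le> 1 / 2"
  and concave_on_ln_powr_bessel_K_iff: "concave_on {0<..} (ln_powr_bessel_K \<nu>) \<longleftrightarrow> 1 / 2 \<le> \<nu>"
proof -
  consider "\<nu> < 1 / 2" | "\<nu> = 1 / 2" | "1 / 2 < \<nu>" by linarith
  then have "(convex_on {0<..} (ln_powr_bessel_K \<nu>) \<longleftrightarrow> \<nu> \<le> 1 / 2) \<and>
    (concave_on {0<..} (ln_powr_bessel_K \<nu>) \<longleftrightarrow> 1 / 2 \<le> \<nu>)"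
  proof cases
    case 1
    then show ?thesis
      using strict_mono_deriv_imp_convex_not_concave[OF ln_powr_bessel_K_has_real_derivative, of \<nu>]
        bessel_K_ratio_strict_antimono[OF 1] by simp
  next
    case 2
    have "convex_on {0<..} (ln_powr_bessel_K (1 / 2))"
      by (rule convex_on_realI[OF _ ln_powr_bessel_K_has_real_derivative]) (auto simp: bessel_K_ratio_half)
    moreover have "concave_on {0<..} (ln_powr_bessel_K (1 / 2))"
      unfolding concave_on_def
      by (rule convex_on_realI[OF _ DERIV_minus[OF ln_powr_bessel_K_has_real_derivative]])
        (auto simp: bessel_K_ratio_half)
    ultimately show ?thesis unfolding 2 by simp
  next
    case 3
    then show ?thesis
      using strict_mono_deriv_imp_convex_not_concave[OF DERIV_minus[OF ln_powr_bessel_K_has_real_derivative], of \<nu>]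
        bessel_K_ratio_strict_mono[OF 3] by (simp add: concave_on_def)
  qed
  then show "convex_on {0<..} (ln_powr_bessel_K \<nu>) \<longleftrightarrow> \<nu> \<le> 1 / 2"
    and "concave_on {0<..} (ln_powr_bessel_K \<nu>) \<longleftrightarrow> 1 / 2 \<le> \<nu>" by auto
qed

section \<open>Transfer to the variance-gamma density\<close>

lemma log_convex_on_iff_convex_on_ln:
  assumes "is_interval I" "\<And>x. x \<in> I \<Longrightarrow> 0 < h x"
  shows "log_convex_on I h \<longleftrightarrow> convex_on I (\<lambda>x. ln (h x))"
    and "log_concave_on I h \<longleftrightarrow> concave_on I (\<lambda>x. ln (h x))"
proof -
  have I: "convex I" using assms(1) by (simp add: is_interval_convex_1)
  have ln_prod: "ln (h x powr t * h y powr (1 - t)) = t * ln (h x) + (1 - t) * ln (h y)"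
    and prod_pos: "0 < h x powr t * h y powr (1 - t)"
    and mem: "t \<in> {0..1} \<Longrightarrow> 0 < h (t * x + (1 - t) * y)"
    if "x \<in> I" "y \<in> I" for x y t
    using assms(2)[OF that(1)] assms(2)[OF that(2)] convexD[OF I that, of t "1 - t"]
    by (auto simp: ln_mult ln_powr intro: assms(2))
  have le: "h (t * x + (1 - t) * y) \<le> h x powr t * h y powr (1 - t) \<longleftrightarrow>
      ln (h (t * x + (1 - t) * y)) \<le> t * ln (h x) + (1 - t) * ln (h y)"
    and ge: "h x powr t * h y powr (1 - t) \<le> h (t * x + (1 - t) * y) \<longleftrightarrow>
      t * ln (h x) + (1 - t) * ln (h y) \<le> ln (h (t * x + (1 - t) * y))"
    if "x \<in> I" "y \<in> I" "t \<in> {0..1}" for x y t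
    using ln_prod[OF that(1,2)] prod_pos[OF that(1,2)] mem[OF that]
    by (metis ln_le_cancel_iff)+
  \<comment> \<open>Reconciles the single weight \<open>t\<close> of the log-convexity notions with
    the two weights summing to \<open>1\<close> in \<open>convex_on_def\<close>.\<close>
  have weights: "(\<forall>t\<in>{0..1::real}. P t (1 - t)) \<longleftrightarrow> (\<forall>u\<ge>0. \<forall>v\<ge>0. u + v = 1 \<longrightarrow> P u v)" for P
  proof (intro iffI ballI allI impI)
    fix u v :: real assume P: "\<forall>t\<in>{0..1}. P t (1 - t)" and "0 \<le> u" "0 \<le> v" "u + v = 1"
    then have "u \<in> {0..1}" "v = 1 - u" by auto
    with P show "P u v" by blast
  qed auto
  show "log_convex_on I h \<longleftrightarrow> convex_on I (\<lambda>x. ln (h x))"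
    using assms I by (simp add: log_convex_on_def convex_on_def le flip: weights)
  show "log_concave_on I h \<longleftrightarrow> concave_on I (\<lambda>x. ln (h x))"
    using assms I by (simp add: log_concave_on_def concave_on_iff ge flip: weights)
qed

lemma vg_density_pos_ln:
  fixes \<nu> \<alpha> \<beta> \<mu> :: real
  assumes "- 1 / 2 < \<nu>" "0 < \<alpha>" "\<bar>\<beta>\<bar> < \<alpha>"
  obtains c where "\<And>x. x \<noteq> \<mu> \<Longrightarrow> 0 < vg_density \<nu> \<alpha> \<beta> \<mu> x"
    and "\<And>x. x \<noteq> \<mu> \<Longrightarrow>
      ln (vg_density \<nu> \<alpha> \<beta> \<mu> x) = c + \<beta> * (x - \<mu>) + ln_powr_bessel_K \<nu> (\<alpha> * \<bar>x - \<mu>\<bar>)"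
proof -
  define C where "C = (\<alpha>\<^sup>2 - \<beta>\<^sup>2) powr (\<nu> + 1/2) / (sqrt pi * (2 * \<alpha>) powr \<nu> * Gamma (\<nu> + 1/2))"
  have "\<beta>\<^sup>2 < \<alpha>\<^sup>2"
    using assms abs_le_square_iff[of \<alpha> \<beta>] by linarith
  then have C: "0 < C"
    using assms by (simp add: C_def Gamma_real_pos)
  show ?thesis
  proof
    fix x assume x: "x \<noteq> \<mu>"
    have K: "0 < bessel_K \<nu> (\<alpha> * \<bar>x - \<mu>\<bar>)"
      using x assms by (intro bessel_K_pos) simp
    show "0 < vg_density \<nu> \<alpha> \<beta> \<mu> x"
      using x K C by (simp add: vg_density_def flip: C_def)
    \<comment> \<open>The correction \<open>\<nu> * ln \<alpha>\<close> arises because the power in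
      the density has base \<open>\<bar>x - \<mu>\<bar>\<close>, while
      \<open>ln_powr_bessel_K\<close> uses \<open>\<alpha> * \<bar>x - \<mu>\<bar>\<close>.\<close>
    show "ln (vg_density \<nu> \<alpha> \<beta> \<mu> x) =
        ln C - \<nu> * ln \<alpha> + \<beta> * (x - \<mu>) + ln_powr_bessel_K \<nu> (\<alpha> * \<bar>x - \<mu>\<bar>)"
      using x K C assms unfolding vg_density_def C_def[symmetric] ln_powr_bessel_K_def
      by (simp add: ln_mult ln_powr distrib_left)
  qed
qed

text \<open>On \<open>I\<close> the log-density is \<open>ln_powr_bessel_K \<nu>\<close> composed
  with an affine bijection onto \<open>{0<..}\<close>, plus an affine function; both changes
  preserve convexity in either direction. The factor \<open>s\<close> covers convexity
  (\<open>s = 1\<close>) and concavity (\<open>s = - 1\<close>) at once.\<close>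

lemma convex_on_ln_vg_density_iff:
  fixes s :: real
  assumes "- 1 / 2 < \<nu>" "0 < \<alpha>" "\<bar>\<beta>\<bar> < \<alpha>" and I: "I = {..<\<mu>} \<or> I = {\<mu><..}"
  shows "convex_on I (\<lambda>x. s * ln (vg_density \<nu> \<alpha> \<beta> \<mu> x)) \<longleftrightarrow>
    convex_on {0<..} (\<lambda>x. s * ln_powr_bessel_K \<nu> x)"
proof -
  obtain c where c: "\<And>x. x \<noteq> \<mu> \<Longrightarrow>
      ln (vg_density \<nu> \<alpha> \<beta> \<mu> x) = c + \<beta> * (x - \<mu>) + ln_powr_bessel_K \<nu> (\<alpha> * \<bar>x - \<mu>\<bar>)"
    using vg_density_pos_ln[OF assms(1-3)] by metis
  \<comment> \<open>\<open>\<sigma>\<close> is the sign of \<open>x - \<mu>\<close> on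
    \<open>I\<close>, so both half-lines are treated together.\<close>
  obtain \<sigma> :: real where \<sigma>_cases: "\<sigma> = 1 \<and> I = {\<mu><..} \<or> \<sigma> = - 1 \<and> I = {..<\<mu>}"
    using I by blast
  then have \<sigma>: "\<sigma> * \<sigma> = 1" by auto
  have mem: "x \<in> I \<longleftrightarrow> 0 < \<sigma> * (x - \<mu>)" for x
    using \<sigma>_cases by auto
  have abs: "\<bar>x - \<mu>\<bar> = \<sigma> * (x - \<mu>)" "x \<noteq> \<mu>" if "x \<in> I" for x
    using \<sigma>_cases that by auto
  have eq: "s * ln (vg_density \<nu> \<alpha> \<beta> \<mu> x) =
      s * ln_powr_bessel_K \<nu> (\<alpha> * \<sigma> * (x - \<mu>)) + s * (c + \<beta> * (x - \<mu>))" if "x \<in> I" for x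
    unfolding c[OF abs(2)[OF that]] abs(1)[OF that] by (simp add: algebra_simps)
  \<comment> \<open>The inverse substitution: \<open>u = \<alpha> * \<sigma> * (x - \<mu>)\<close>
    solved for \<open>x\<close>, using \<open>\<sigma> * \<sigma> = 1\<close>.\<close>
  have eq': "s * ln_powr_bessel_K \<nu> u =
      s * ln (vg_density \<nu> \<alpha> \<beta> \<mu> (\<mu> + \<sigma> * u / \<alpha>)) - s * (c + \<beta> * (\<sigma> * u / \<alpha>))"
    and mem': "\<mu> + \<sigma> * u / \<alpha> \<in> I" if "0 < u" for u
  proof -
    have u: "\<sigma> * (\<mu> + \<sigma> * u / \<alpha> - \<mu>) = u / \<alpha>" "\<alpha> * \<sigma> * (\<mu> + \<sigma> * u / \<alpha> - \<mu>) = u"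
      using \<sigma> assms(2) by (simp_all flip: mult.assoc)
    show mem': "\<mu> + \<sigma> * u / \<alpha> \<in> I"
      unfolding mem u(1) using that assms(2) by simp
    show "s * ln_powr_bessel_K \<nu> u =
        s * ln (vg_density \<nu> \<alpha> \<beta> \<mu> (\<mu> + \<sigma> * u / \<alpha>)) - s * (c + \<beta> * (\<sigma> * u / \<alpha>))"
      using eq[OF mem'] unfolding u(2) by simp
  qed
  have "convex I" using I by auto
  show ?thesis
  proof
    assume conv: "convex_on I (\<lambda>x. s * ln (vg_density \<nu> \<alpha> \<beta> \<mu> x))"
    show "convex_on {0<..} (\<lambda>x. s * ln_powr_bessel_K \<nu> x)"
    proof (rule convex_onI)
      fix t x y :: real assume t: "0 < t" "t < 1" and xy: "x \<in> {0<..}" "y \<in> {0<..}"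
      define z where "z = (1 - t) *\<^sub>R x + t *\<^sub>R y"
      have "0 < z" using t xy by (simp add: z_def add_pos_pos)
      have "\<mu> + \<sigma> * z / \<alpha> = (1 - t) *\<^sub>R (\<mu> + \<sigma> * x / \<alpha>) + t *\<^sub>R (\<mu> + \<sigma> * y / \<alpha>)"
        using assms(2) by (simp add: z_def field_simps)
      then have "s * ln (vg_density \<nu> \<alpha> \<beta> \<mu> (\<mu> + \<sigma> * z / \<alpha>))
          \<le> (1 - t) * (s * ln (vg_density \<nu> \<alpha> \<beta> \<mu> (\<mu> + \<sigma> * x / \<alpha>)))
            + t * (s * ln (vg_density \<nu> \<alpha> \<beta> \<mu> (\<mu> + \<sigma> * y / \<alpha>)))"
        using convex_onD[OF conv, of t "\<mu> + \<sigma> * x / \<alpha>" "\<mu> + \<sigma> * y / \<alpha>"] t mem' xy by simp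
      moreover have "s * (c + \<beta> * (\<sigma> * z / \<alpha>)) =
          (1 - t) * (s * (c + \<beta> * (\<sigma> * x / \<alpha>))) + t * (s * (c + \<beta> * (\<sigma> * y / \<alpha>)))"
        using assms(2) by (simp add: z_def field_simps)
      \<comment> \<open>Separates the log-density terms, related by an inequality, from the affine
        terms, related by an equality, so that \<open>diff_mono\<close> applies.\<close>
      moreover have "(1 - t) * (a - a') + t * (b - b') = (1 - t) * a + t * b - ((1 - t) * a' + t * b')"
        for a a' b b' by (simp add: algebra_simps)
      moreover have "0 < x" "0 < y" using xy by simp_all
      ultimately have "s * ln_powr_bessel_K \<nu> z
          \<le> (1 - t) * (s * ln_powr_bessel_K \<nu> x) + t * (s * ln_powr_bessel_K \<nu> y)"
        by (simp only: eq' \<open>0 < z\<close> diff_mono order_refl)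
      then show "s * ln_powr_bessel_K \<nu> ((1 - t) *\<^sub>R x + t *\<^sub>R y)
          \<le> (1 - t) * (s * ln_powr_bessel_K \<nu> x) + t * (s * ln_powr_bessel_K \<nu> y)"
        unfolding z_def .
    qed simp
  next
    assume conv: "convex_on {0<..} (\<lambda>x. s * ln_powr_bessel_K \<nu> x)"
    show "convex_on I (\<lambda>x. s * ln (vg_density \<nu> \<alpha> \<beta> \<mu> x))"
    proof (rule convex_onI)
      fix t x y :: real assume t: "0 < t" "t < 1" and xy: "x \<in> I" "y \<in> I"
      define z where "z = (1 - t) *\<^sub>R x + t *\<^sub>R y"
      have "z \<in> I"
        using convexD_alt[OF \<open>convex I\<close> xy, of t] t by (simp add: z_def)
      have "\<alpha> * \<sigma> * (z - \<mu>) = (1 - t) *\<^sub>R (\<alpha> * \<sigma> * (x - \<mu>)) + t *\<^sub>R (\<alpha> * \<sigma> * (y - \<mu>))"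
        by (simp add: z_def algebra_simps)
      then have "s * ln_powr_bessel_K \<nu> (\<alpha> * \<sigma> * (z - \<mu>))
          \<le> (1 - t) * (s * ln_powr_bessel_K \<nu> (\<alpha> * \<sigma> * (x - \<mu>)))
            + t * (s * ln_powr_bessel_K \<nu> (\<alpha> * \<sigma> * (y - \<mu>)))"
        using convex_onD[OF conv, of t "\<alpha> * \<sigma> * (x - \<mu>)" "\<alpha> * \<sigma> * (y - \<mu>)"] t xy mem assms(2)
        by (simp add: mult.assoc)
      moreover have "s * (c + \<beta> * (z - \<mu>)) =
          (1 - t) * (s * (c + \<beta> * (x - \<mu>))) + t * (s * (c + \<beta> * (y - \<mu>)))"
        by (simp add: z_def algebra_simps)
      moreover have "(1 - t) * (a + a') + t * (b + b') = (1 - t) * a + t * b + ((1 - t) * a' + t * b')"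
        for a a' b b' by (simp add: algebra_simps)
      ultimately have "s * ln (vg_density \<nu> \<alpha> \<beta> \<mu> z)
          \<le> (1 - t) * (s * ln (vg_density \<nu> \<alpha> \<beta> \<mu> x)) + t * (s * ln (vg_density \<nu> \<alpha> \<beta> \<mu> y))"
        unfolding eq[OF \<open>z \<in> I\<close>] eq[OF xy(1)] eq[OF xy(2)] by (simp only: add_mono order_refl)
      then show "s * ln (vg_density \<nu> \<alpha> \<beta> \<mu> ((1 - t) *\<^sub>R x + t *\<^sub>R y))
          \<le> (1 - t) * (s * ln (vg_density \<nu> \<alpha> \<beta> \<mu> x)) + t * (s * ln (vg_density \<nu> \<alpha> \<beta> \<mu> y))"
        unfolding z_def .
    qed (rule \<open>convex I\<close>)
  qed
qed

lemma log_convex_on_vg_density_iff: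
  assumes "- 1 / 2 < \<nu>" "0 < \<alpha>" "\<bar>\<beta>\<bar> < \<alpha>" and I: "I = {..<\<mu>} \<or> I = {\<mu><..}"
  shows "log_convex_on I (vg_density \<nu> \<alpha> \<beta> \<mu>) \<longleftrightarrow> \<nu> \<le> 1 / 2"
    and "log_concave_on I (vg_density \<nu> \<alpha> \<beta> \<mu>) \<longleftrightarrow> 1 / 2 \<le> \<nu>"
proof -
  have pos: "0 < vg_density \<nu> \<alpha> \<beta> \<mu> x" if "x \<noteq> \<mu>" for x
    using vg_density_pos_ln[OF assms(1-3), of \<mu>] that by metis
  have "is_interval I"
    using I by (auto simp: is_interval_convex_1)
  moreover have "0 < vg_density \<nu> \<alpha> \<beta> \<mu> x" if "x \<in> I" for x
    using I that by (intro pos) auto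
  ultimately have *: "log_convex_on I (vg_density \<nu> \<alpha> \<beta> \<mu>) \<longleftrightarrow> convex_on I (\<lambda>x. ln (vg_density \<nu> \<alpha> \<beta> \<mu> x))"
    "log_concave_on I (vg_density \<nu> \<alpha> \<beta> \<mu>) \<longleftrightarrow> concave_on I (\<lambda>x. ln (vg_density \<nu> \<alpha> \<beta> \<mu> x))"
    by (blast intro!: log_convex_on_iff_convex_on_ln)+
  show "log_convex_on I (vg_density \<nu> \<alpha> \<beta> \<mu>) \<longleftrightarrow> \<nu> \<le> 1 / 2"
    using convex_on_ln_vg_density_iff[OF assms, of 1]
    by (simp add: * convex_on_ln_powr_bessel_K_iff)
  show "log_concave_on I (vg_density \<nu> \<alpha> \<beta> \<mu>) \<longleftrightarrow> 1 / 2 \<le> \<nu>"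
    using convex_on_ln_vg_density_iff[OF assms, of "- 1"] concave_on_ln_powr_bessel_K_iff[of \<nu>]
    by (simp add: * concave_on_def)
qed

text \<open>The log-density is a constant plus
  \<open>\<beta> * (x - \<mu>) - \<alpha> * \<bar>x - \<mu>\<bar>\<close>, with slope
  \<open>\<beta> + \<alpha>\<close> left of \<open>\<mu>\<close> and
  \<open>\<beta> - \<alpha>\<close> right of it.\<close>

lemma log_affine_on_vg_density_half:
  assumes "0 < \<alpha>" "\<bar>\<beta>\<bar> < \<alpha>"
  shows "log_affine_on {..<\<mu>} (vg_density (1 / 2) \<alpha> \<beta> \<mu>)"
    and "log_affine_on {\<mu><..} (vg_density (1 / 2) \<alpha> \<beta> \<mu>)"
proof -
  obtain c where pos: "\<And>x. x \<noteq> \<mu> \<Longrightarrow> 0 < vg_density (1 / 2) \<alpha> \<beta> \<mu> x"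
    and c: "\<And>x. x \<noteq> \<mu> \<Longrightarrow>
      ln (vg_density (1 / 2) \<alpha> \<beta> \<mu> x) = c + \<beta> * (x - \<mu>) + ln_powr_bessel_K (1 / 2) (\<alpha> * \<bar>x - \<mu>\<bar>)"
    using vg_density_pos_ln[of "1 / 2", OF _ assms] by auto
  obtain d where d: "\<And>x. 0 < x \<Longrightarrow> ln_powr_bessel_K (1 / 2) x = d - x"
    using ln_powr_bessel_K_half by blast
  have ln: "ln (vg_density (1 / 2) \<alpha> \<beta> \<mu> x) = c + d + \<beta> * (x - \<mu>) - \<alpha> * \<bar>x - \<mu>\<bar>" if "x \<noteq> \<mu>" for x
    using c[OF that] d[of "\<alpha> * \<bar>x - \<mu>\<bar>"] that assms(1) by simp
  have "\<forall>x\<in>{..<\<mu>}. ln (vg_density (1 / 2) \<alpha> \<beta> \<mu> x) = (\<beta> + \<alpha>) * x + (c + d - (\<beta> + \<alpha>) * \<mu>)"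
    by (simp add: ln algebra_simps)
  then show "log_affine_on {..<\<mu>} (vg_density (1 / 2) \<alpha> \<beta> \<mu>)"
    unfolding log_affine_on_def by (auto simp: is_interval_convex_1 pos)
  have "\<forall>x\<in>{\<mu><..}. ln (vg_density (1 / 2) \<alpha> \<beta> \<mu> x) = (\<beta> - \<alpha>) * x + (c + d - (\<beta> - \<alpha>) * \<mu>)"
    by (simp add: ln algebra_simps)
  then show "log_affine_on {\<mu><..} (vg_density (1 / 2) \<alpha> \<beta> \<mu>)"
    unfolding log_affine_on_def by (auto simp: is_interval_convex_1 pos)
qed

theorem corollary2p7:
  fixes \<nu> \<alpha> \<beta> \<mu> :: real
  assumes "\<nu> > -1/2" and "\<alpha> > 0" and "\<bar>\<beta>\<bar> < \<alpha>"
  shows "((log_convex_on {..<\<mu>} (vg_density \<nu> \<alpha> \<beta> \<mu>) \<and>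
           log_convex_on {\<mu><..} (vg_density \<nu> \<alpha> \<beta> \<mu>)) \<longleftrightarrow> -1/2 < \<nu> \<and> \<nu> \<le> 1/2)
       \<and> ((log_concave_on {..<\<mu>} (vg_density \<nu> \<alpha> \<beta> \<mu>) \<and>
           log_concave_on {\<mu><..} (vg_density \<nu> \<alpha> \<beta> \<mu>)) \<longleftrightarrow> \<nu> \<ge> 1/2)
       \<and> (\<nu> = 1/2 \<longrightarrow>
           log_affine_on {..<\<mu>} (vg_density \<nu> \<alpha> \<beta> \<mu>) \<and>
           log_affine_on {\<mu><..} (vg_density \<nu> \<alpha> \<beta> \<mu>))"
proof (intro conjI impI)
  \<comment> \<open>Each half-line separately yields the same condition on \<open>\<nu>\<close>, so
    the conjunctions collapse to it.\<close>
  note iffs = log_convex_on_vg_density_iff[OF assms, of "{..<\<mu>}" \<mu>]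
    log_convex_on_vg_density_iff[OF assms, of "{\<mu><..}" \<mu>]
  show "(log_convex_on {..<\<mu>} (vg_density \<nu> \<alpha> \<beta> \<mu>) \<and> log_convex_on {\<mu><..} (vg_density \<nu> \<alpha> \<beta> \<mu>))
      \<longleftrightarrow> -1/2 < \<nu> \<and> \<nu> \<le> 1/2"
    using iffs assms(1) by blast
  show "(log_concave_on {..<\<mu>} (vg_density \<nu> \<alpha> \<beta> \<mu>) \<and> log_concave_on {\<mu><..} (vg_density \<nu> \<alpha> \<beta> \<mu>))
      \<longleftrightarrow> \<nu> \<ge> 1/2"
    using iffs by blast
  assume "\<nu> = 1/2"
  then show "log_affine_on {..<\<mu>} (vg_density \<nu> \<alpha> \<beta> \<mu>)" "log_affine_on {\<mu><..} (vg_density \<nu> \<alpha> \<beta> \<mu>)"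
    using log_affine_on_vg_density_half[OF assms(2,3), of \<mu>] by (simp_all only:)
qed

end
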